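(* Let $n\ge1$, let $y_j=\sum_{i=1}^n x_i^{2j}$ for $1\le j\le n$, let $\Delta=2^n n!\,x_1\cdots x_n\prod_{1\le i<j\le n}(x_j^2-x_i^2)$, let $\tilde{\mathcal O}_X=\mathbb C[x_1,\dots,x_n,\Delta^{-1}]$ and let $\tilde{\mathcal D}_Y=\mathbb C\langle y_1,\dots,y_n,\partial/\partial y_1,\dots,\partial/\partial y_n,\Delta^{-2}\rangle$. Then $\tilde{\mathcal O}_X$ is a $\tilde{\mathcal D}_Y$-module, where $y_j$ and $\Delta^{-2}$ act by multiplication and $\partial/\partial y_1,\dots,\partial/\partial y_n$ act through $$\begin{pmatrix}\partial/\partial y_1\\ \vdots\\ \partial/\partial y_n\end{pmatrix}=A^{-1}\begin{pmatrix}\partial/\partial x_1\\ \vdots\\ \partial/\partial x_n\end{pmatrix},\qquad A=(2j\,x_i^{2j-1})_{1\le i,j\le n}.$$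
   Context: In $A$ the row index is $i$ and the column index is $j$; $\det A=\Delta$, so $A$ is invertible over $\tilde{\mathcal O}_X$. The group $W=W(B_n)=(\mathbb Z/2\mathbb Z)^n\rtimes\mathcal S_n$ acts on $\mathbb C[x_1,\dots,x_n]$ by permutations and sign changes of the variables, and $\mathbb C[x_1,\dots,x_n]^W=\mathbb C[y_1,\dots,y_n]$ is a polynomial ring in $y_1,\dots,y_n$; $\Delta^2$ is $W$-invariant, hence a polynomial in $y_1,\dots,y_n$. $\tilde{\mathcal D}_Y$ is the Weyl algebra $\mathbb C\langle y_1,\dots,y_n,\partial/\partial y_1,\dots,\partial/\partial y_n\rangle$ localized at $\Delta^2$. *)

theory Defs
  imports
    "HOL-Library.Poly_Mapping"
    "HOL-Computational_Algebra.Fraction_Field"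
    "HOL-Algebra.QuotRing"
    "HOL-Algebra.Module"
    "Jordan_Normal_Form.Gauss_Jordan_Elimination"
begin

(* Variables are numbered from 0: x i, y j with i, j < n stand for x_{i+1}, y_{j+1}. *)

section \<open>Polynomials and rational functions\<close>

(* Monoid algebra of the free commutative monoid on countably many variables. *)
type_synonym cpoly = "(nat \<Rightarrow>\<^sub>0 nat) \<Rightarrow>\<^sub>0 complex"

type_synonym crat = "cpoly fract"

abbreviation const :: "complex \<Rightarrow> 'm::monoid_add \<Rightarrow>\<^sub>0 complex" where
  "const c \<equiv> Poly_Mapping.single 0 c"

definition X :: "nat \<Rightarrow> cpoly" where
  "X i = Poly_Mapping.single (Poly_Mapping.single i 1) 1"

definition polys_in :: "nat \<Rightarrow> cpoly set" where
  "polys_in n = {p. \<forall>m \<in> Poly_Mapping.keys p. Poly_Mapping.keys m \<subseteq> {..<n}}"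

(* Substitution of v 0, ..., v (n-1) for the variables. The values lie in a monoid algebra that
   need not be commutative; the powers are multiplied in the order v 0, ..., v (n-1). *)
definition subst_poly ::
  "nat \<Rightarrow> (nat \<Rightarrow> ('m::monoid_add \<Rightarrow>\<^sub>0 complex)) \<Rightarrow> cpoly \<Rightarrow> ('m \<Rightarrow>\<^sub>0 complex)" where
  "subst_poly n v p =
     (\<Sum>m\<in>Poly_Mapping.keys p. const (Poly_Mapping.lookup p m) * prod_list (map (\<lambda>j. v j ^ Poly_Mapping.lookup m j) [0..<n]))"

(* If Poly_Mapping.lookup m i = 0, the coefficient vanishes and the truncated exponent is irrelevant. *)
definition dpoly :: "nat \<Rightarrow> cpoly \<Rightarrow> cpoly" where
  "dpoly i p = (\<Sum>m\<in>Poly_Mapping.keys p. Poly_Mapping.single (m - Poly_Mapping.single i 1)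
                                (of_nat (Poly_Mapping.lookup m i) * Poly_Mapping.lookup p m))"

lemma dpoly_superset:
  assumes "finite S" "Poly_Mapping.keys p \<subseteq> S"
  shows "dpoly i p = (\<Sum>m\<in>S. Poly_Mapping.single (m - Poly_Mapping.single i 1)
                                (of_nat (Poly_Mapping.lookup m i) * Poly_Mapping.lookup p m))"
  unfolding dpoly_def
  by (rule sum.mono_neutral_left) (use assms in \<open>auto simp: in_keys_iff\<close>)

lemma dpoly_zero: "dpoly i 0 = 0"
  by (simp add: dpoly_def)

lemma dpoly_add: "dpoly i (p + q) = dpoly i p + dpoly i q"
proof -
  let ?S = "Poly_Mapping.keys p \<union> Poly_Mapping.keys q"
  have "Poly_Mapping.keys (p + q) \<subseteq> ?S" by (rule Poly_Mapping.keys_add)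
  then show ?thesis
    by (simp add: dpoly_superset[of ?S] lookup_add distrib_left single_add sum.distrib)
qed

lemma dpoly_sum: "dpoly i (sum f S) = (\<Sum>s\<in>S. dpoly i (f s))"
  by (induction S rule: infinite_finite_induct) (auto simp: dpoly_zero dpoly_add)

lemma dpoly_single:
  "dpoly i (Poly_Mapping.single m c) =
     Poly_Mapping.single (m - Poly_Mapping.single i 1) (of_nat (Poly_Mapping.lookup m i) * c)"
  by (cases "c = 0") (auto simp: dpoly_def)

lemma cpoly_expand: "(\<Sum>m\<in>Poly_Mapping.keys p. Poly_Mapping.single m (Poly_Mapping.lookup p m)) = (p :: cpoly)"
proof (rule poly_mapping_eqI)
  fix k
  have "Poly_Mapping.lookup (\<Sum>m\<in>Poly_Mapping.keys p. Poly_Mapping.single m (Poly_Mapping.lookup p m)) k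
      = (\<Sum>m\<in>Poly_Mapping.keys p. if m = k then Poly_Mapping.lookup p k else 0)"
    by (auto simp: lookup_sum lookup_single when_def intro!: sum.cong)
  also have "\<dots> = Poly_Mapping.lookup p k"
    by (simp add: in_keys_iff)
  finally show "Poly_Mapping.lookup (\<Sum>m\<in>Poly_Mapping.keys p. Poly_Mapping.single m (Poly_Mapping.lookup p m)) k = Poly_Mapping.lookup p k" .
qed

lemma monomial_shift:
  fixes m m' :: "nat \<Rightarrow>\<^sub>0 nat"
  assumes "Poly_Mapping.lookup m i \<noteq> 0"
  shows "m + m' - Poly_Mapping.single i 1 = (m - Poly_Mapping.single i 1) + m'"
  by (rule poly_mapping_eqI) (use assms in \<open>auto simp: lookup_add lookup_minus lookup_single when_def\<close>)

lemma dpoly_mult_single: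
  "dpoly i (Poly_Mapping.single m c * Poly_Mapping.single m' c') =
     dpoly i (Poly_Mapping.single m c) * Poly_Mapping.single m' c'
     + Poly_Mapping.single m c * dpoly i (Poly_Mapping.single m' c')"
proof -
  have 1: "Poly_Mapping.single (m + m' - Poly_Mapping.single i 1) (of_nat (Poly_Mapping.lookup m i) * c * c') =
      Poly_Mapping.single ((m - Poly_Mapping.single i 1) + m') (of_nat (Poly_Mapping.lookup m i) * c * c')"
    by (cases "Poly_Mapping.lookup m i = 0") (use monomial_shift[of m i m'] in auto)
  have 2: "Poly_Mapping.single (m + m' - Poly_Mapping.single i 1) (c * (of_nat (Poly_Mapping.lookup m' i) * c')) =
      Poly_Mapping.single (m + (m' - Poly_Mapping.single i 1)) (c * (of_nat (Poly_Mapping.lookup m' i) * c'))"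
    by (cases "Poly_Mapping.lookup m' i = 0") (use monomial_shift[of m' i m] in \<open>auto simp: add.commute\<close>)
  show ?thesis
    unfolding mult_single dpoly_single 1[symmetric] 2[symmetric] single_add[symmetric]
    by (simp add: lookup_add algebra_simps)
qed

lemma dpoly_mult: "dpoly i (p * q) = dpoly i p * q + p * dpoly i q"
proof -
  let ?s = "\<lambda>r m. Poly_Mapping.single m (Poly_Mapping.lookup r m) :: cpoly"
  have "dpoly i ((\<Sum>m\<in>Poly_Mapping.keys p. ?s p m) * (\<Sum>m\<in>Poly_Mapping.keys q. ?s q m)) =
      dpoly i (\<Sum>m\<in>Poly_Mapping.keys p. ?s p m) * (\<Sum>m\<in>Poly_Mapping.keys q. ?s q m)
      + (\<Sum>m\<in>Poly_Mapping.keys p. ?s p m) * dpoly i (\<Sum>m\<in>Poly_Mapping.keys q. ?s q m)"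
    by (simp add: dpoly_sum sum_product dpoly_mult_single sum.distrib)
  then show ?thesis
    by (simp add: cpoly_expand)
qed

lift_definition drat :: "nat \<Rightarrow> crat \<Rightarrow> crat" is
  "\<lambda>i q. (dpoly i (fst q) * snd q - fst q * dpoly i (snd q), snd q * snd q)"
proof -
  fix i :: nat and q r :: "cpoly \<times> cpoly"
  assume asm: "fractrel q r"
  obtain a b c d where qr: "q = (a, b)" "r = (c, d)" by (cases q, cases r)
  from asm have nz: "b \<noteq> 0" "d \<noteq> 0" and e: "a * d = c * b" by (auto simp: qr)
  have l: "dpoly i a * d = dpoly i c * b + c * dpoly i b - a * dpoly i d"
    using arg_cong[OF e, of "dpoly i"] by (simp add: dpoly_mult algebra_simps)
  have "(dpoly i a * b - a * dpoly i b) * (d * d)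
      = b * d * (dpoly i a * d) - (a * d) * dpoly i b * d"
    by (simp add: algebra_simps)
  also have "\<dots> = (dpoly i c * d) * (b * b) - b * dpoly i d * (a * d)"
    unfolding l using e by (simp add: algebra_simps)
  also have "\<dots> = (dpoly i c * d - c * dpoly i d) * (b * b)"
    unfolding e by (simp add: algebra_simps)
  finally show "fractrel
      (dpoly i (fst q) * snd q - fst q * dpoly i (snd q), snd q * snd q)
      (dpoly i (fst r) * snd r - fst r * dpoly i (snd r), snd r * snd r)"
    using nz by (simp add: qr)
qed

lemma drat_Fract:
  assumes "b \<noteq> 0"
  shows "drat i (Fraction_Field.Fract a b) =
    Fraction_Field.Fract (dpoly i a * b - a * dpoly i b) (b * b)"
  using assms by (simp add: Fraction_Field.Fract.abs_eq drat.abs_eq)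

abbreviation of_cpoly :: "cpoly \<Rightarrow> crat" where
  "of_cpoly p \<equiv> Fraction_Field.Fract p 1"

section \<open>The data of the statement\<close>

definition Y :: "nat \<Rightarrow> nat \<Rightarrow> cpoly" where
  "Y n j = (\<Sum>i<n. X i ^ (2 * Suc j))"

definition Delta :: "nat \<Rightarrow> cpoly" where
  "Delta n = 2 ^ n * fact n * (\<Prod>i<n. X i) * (\<Prod>j<n. \<Prod>i<j. X j ^ 2 - X i ^ 2)"

(* The polynomial expressing Delta^2 in terms of y_1, ..., y_n. It exists because Delta^2 is
   invariant under W(B_n), and is unique because y_1, ..., y_n are algebraically independent. *)
definition Delta_sq_poly :: "nat \<Rightarrow> cpoly" where
  "Delta_sq_poly n = (SOME P. P \<in> polys_in n \<and> subst_poly n (Y n) P = Delta n ^ 2)"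

definition A_mat :: "nat \<Rightarrow> crat mat" where
  "A_mat n = mat n n (\<lambda>(i, j). of_cpoly (of_nat (2 * Suc j) * X i ^ (2 * Suc j - 1)))"

(* C[x_1, ..., x_n, Delta^{-1}] as a subring of the field of rational functions. *)
definition OX :: "nat \<Rightarrow> crat set" where
  "OX n = {Fraction_Field.Fract p (Delta n ^ k) | p k. p \<in> polys_in n}"

section \<open>The localized Weyl algebra\<close>

(* The free monoid, written additively so that its monoid algebra, which is the free associative
   algebra, is provided by poly_mapping. *)
datatype 'g free_monoid = FM (letters: "'g list")

instantiation free_monoid :: (type) monoid_add
begin

definition zero_free_monoid :: "'a free_monoid" where
  "0 = FM []"

definition plus_free_monoid :: "'a free_monoid \<Rightarrow> 'a free_monoid \<Rightarrow> 'a free_monoid" where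
  "u + v = FM (letters u @ letters v)"

instance
  by standard (simp_all add: zero_free_monoid_def plus_free_monoid_def)

end

type_synonym 'g free_alg = "'g free_monoid \<Rightarrow>\<^sub>0 complex"

definition gen :: "'g \<Rightarrow> 'g free_alg" where
  "gen g = Poly_Mapping.single (FM [g]) 1"

definition ring_on :: "'a::ring_1 set \<Rightarrow> 'a ring" where
  "ring_on S = \<lparr>carrier = S, monoid.mult = (*), one = 1, zero = 0, add = (+)\<rparr>"

definition free_alg_on :: "'g set \<Rightarrow> 'g free_alg ring" where
  "free_alg_on G = ring_on {p. \<forall>w \<in> Poly_Mapping.keys p. set (letters w) \<subseteq> G}"

(* GInv stands for Delta^{-2}. *)
datatype weyl_gen = GY nat | GD nat | GInv

definition weyl_gens :: "nat \<Rightarrow> weyl_gen set" where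
  "weyl_gens n = GY ` {..<n} \<union> GD ` {..<n} \<union> {GInv}"

definition weyl_relators :: "nat \<Rightarrow> weyl_gen free_alg set" where
  "weyl_relators n =
     {gen (GY i) * gen (GY j) - gen (GY j) * gen (GY i) | i j. i < n \<and> j < n}
   \<union> {gen (GD i) * gen (GD j) - gen (GD j) * gen (GD i) | i j. i < n \<and> j < n}
   \<union> {gen (GD i) * gen (GY j) - gen (GY j) * gen (GD i) - (if i = j then 1 else 0)
        | i j. i < n \<and> j < n}
   \<union> {gen GInv * subst_poly n (\<lambda>j. gen (GY j)) (Delta_sq_poly n) - 1,
      subst_poly n (\<lambda>j. gen (GY j)) (Delta_sq_poly n) * gen GInv - 1}"

definition weyl_ideal :: "nat \<Rightarrow> weyl_gen free_alg set" where
  "weyl_ideal n = genideal (free_alg_on (weyl_gens n)) (weyl_relators n)"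

(* The localization of a noncommutative ring at an element is obtained by freely adjoining a
   two-sided inverse of that element. *)
definition DY :: "nat \<Rightarrow> weyl_gen free_alg set ring" where
  "DY n = free_alg_on (weyl_gens n) Quot weyl_ideal n"

definition DY_class :: "nat \<Rightarrow> weyl_gen free_alg \<Rightarrow> weyl_gen free_alg set" where
  "DY_class n p = weyl_ideal n +>\<^bsub>free_alg_on (weyl_gens n)\<^esub> p"

section \<open>Left modules over a noncommutative ring\<close>

(* The axioms of the library locale module, which requires a commutative ring of scalars. *)
locale left_module = R?: ring R + M?: abelian_group M for R (structure) and M (structure) +
  assumes smult_closed:
      "\<lbrakk>a \<in> carrier R; x \<in> carrier M\<rbrakk> \<Longrightarrow> a \<odot>\<^bsub>M\<^esub> x \<in> carrier M"
    and smult_l_distr: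
      "\<lbrakk>a \<in> carrier R; b \<in> carrier R; x \<in> carrier M\<rbrakk> \<Longrightarrow>
       (a \<oplus>\<^bsub>R\<^esub> b) \<odot>\<^bsub>M\<^esub> x = a \<odot>\<^bsub>M\<^esub> x \<oplus>\<^bsub>M\<^esub> b \<odot>\<^bsub>M\<^esub> x"
    and smult_r_distr:
      "\<lbrakk>a \<in> carrier R; x \<in> carrier M; y \<in> carrier M\<rbrakk> \<Longrightarrow>
       a \<odot>\<^bsub>M\<^esub> (x \<oplus>\<^bsub>M\<^esub> y) = a \<odot>\<^bsub>M\<^esub> x \<oplus>\<^bsub>M\<^esub> a \<odot>\<^bsub>M\<^esub> y"
    and smult_assoc:
      "\<lbrakk>a \<in> carrier R; b \<in> carrier R; x \<in> carrier M\<rbrakk> \<Longrightarrow>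
       (a \<otimes>\<^bsub>R\<^esub> b) \<odot>\<^bsub>M\<^esub> x = a \<odot>\<^bsub>M\<^esub> (b \<odot>\<^bsub>M\<^esub> x)"
    and smult_one:
      "x \<in> carrier M \<Longrightarrow> \<one>\<^bsub>R\<^esub> \<odot>\<^bsub>M\<^esub> x = x"

definition OX_module ::
  "nat \<Rightarrow> ('r \<Rightarrow> crat \<Rightarrow> crat) \<Rightarrow> ('r, crat) module" where
  "OX_module n act =
     \<lparr>carrier = OX n, monoid.mult = (*), one = 1, zero = 0, add = (+), smult = act\<rparr>"

end

theory Submission
  imports
    Defs
    "Jordan_Normal_Form.Determinant"
    "HOL-Computational_Algebra.Formal_Power_Series"
begin

text \<open>
  The localized Weyl algebra is a quotient of a free algebra, so a module structure on the ring of
  functions is the same as a choice of linear operators for the generators that satisfies the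
  defining relations. The operators are prescribed: multiplication by \<open>y\<^sub>j\<close>, multiplication by
  \<open>\<Delta>\<^sup>-\<^sup>2\<close>, and the vector fields \<open>D\<^sub>j = \<Sum>\<^sub>i B\<^sub>j\<^sub>i \<partial>/\<partial>x\<^sub>i\<close> with \<open>B = A\<^sup>-\<^sup>1\<close>. Three things have to be seen.

  The matrix \<open>B\<close> exists over the ring of functions: \<open>A\<close> is a Vandermonde matrix in the squares
  \<open>x\<^sub>i\<^sup>2\<close> between two diagonal matrices, so its determinant is \<open>\<Delta>\<close> (\<open>det_jacobian\<close>), and \<open>B\<close> is the
  adjugate divided by \<open>\<Delta>\<close>.

  The Weyl relations hold. The matrix \<open>A\<close> is the Jacobian matrix of the \<open>y\<^sub>j\<close>, whence
  \<open>D\<^sub>j y\<^sub>k = \<delta>\<^sub>j\<^sub>k\<close>, and the Leibniz rule gives the relation between \<open>D\<^sub>j\<close> and \<open>y\<^sub>k\<close>. The commutator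
  of \<open>D\<^sub>j\<close> and \<open>D\<^sub>k\<close> is again a vector field; it kills every \<open>y\<^sub>l\<close>, because \<open>D\<^sub>k y\<^sub>l\<close> and \<open>D\<^sub>j y\<^sub>l\<close> are
  constants, and a vector field with this property vanishes because \<open>A\<close> is invertible
  (\<open>dy_commute\<close>).

  The relation that makes \<open>\<Delta>\<^sup>2\<close> invertible refers to \<open>\<Delta>\<^sup>2\<close> written as a polynomial in the \<open>y\<^sub>j\<close>. Such
  a polynomial exists because \<open>\<Delta>\<^sup>2 = det (A\<^sup>T A)\<close> and the entries of \<open>A\<^sup>T A\<close> are multiples of power
  sums of the \<open>x\<^sub>i\<^sup>2\<close>; by Newton's identities all power sums are polynomials in the first \<open>n\<close> of them,
  which are the \<open>y\<^sub>j\<close> (\<open>Delta_square_polynomial_in_Y\<close>).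

  Finally the annihilator of a module is an ideal, so it contains the ideal generated by the
  relations, and the action of the free algebra descends to the quotient (\<open>left_module_Quot\<close>).
\<close>

section \<open>Unital subrings\<close>

locale unital_subring =
  fixes S :: "'a::ring_1 set"
  assumes one_closed: "1 \<in> S"
    and diff_closed: "\<lbrakk>a \<in> S; b \<in> S\<rbrakk> \<Longrightarrow> a - b \<in> S"
    and mult_closed: "\<lbrakk>a \<in> S; b \<in> S\<rbrakk> \<Longrightarrow> a * b \<in> S"
begin

lemma zero_closed: "0 \<in> S"
  using diff_closed[OF one_closed one_closed] by simp

lemma uminus_closed: "a \<in> S \<Longrightarrow> - a \<in> S"
  using diff_closed[OF zero_closed, of a] by simp

lemma add_closed: "\<lbrakk>a \<in> S; b \<in> S\<rbrakk> \<Longrightarrow> a + b \<in> S"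
  using diff_closed[OF _ uminus_closed, of a b] by simp

lemma sum_closed: "(\<And>i. i \<in> I \<Longrightarrow> f i \<in> S) \<Longrightarrow> sum f I \<in> S"
  by (induction I rule: infinite_finite_induct) (auto intro: zero_closed add_closed)

lemma power_closed: "a \<in> S \<Longrightarrow> a ^ k \<in> S"
  by (induction k) (auto intro: one_closed mult_closed)

lemma of_nat_closed: "of_nat k \<in> S"
  by (induction k) (auto intro: zero_closed one_closed add_closed)

lemma prod_list_closed: "(\<And>x. x \<in> set xs \<Longrightarrow> x \<in> S) \<Longrightarrow> prod_list xs \<in> S"
  by (induction xs) (auto intro: one_closed mult_closed)

lemma ring_ring_on: "ring (ring_on S)"
proof (rule ringI)
  show "abelian_group (ring_on S)"
  proof (rule abelian_groupI)
    fix x assume "x \<in> carrier (ring_on S)"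
    then show "\<exists>y\<in>carrier (ring_on S). y \<oplus>\<^bsub>ring_on S\<^esub> x = \<zero>\<^bsub>ring_on S\<^esub>"
      by (intro bexI[of _ "- x"]) (auto simp: ring_on_def uminus_closed)
  qed (auto simp: ring_on_def add_closed zero_closed add_ac)
  show "Group.monoid (ring_on S)"
    by (rule monoidI) (auto simp: ring_on_def mult_closed one_closed mult.assoc)
qed (auto simp: ring_on_def algebra_simps)

end

lemma prod_in_unital_subring:
  fixes f :: "'b \<Rightarrow> 'a::comm_ring_1"
  assumes "unital_subring S" "\<And>i. i \<in> I \<Longrightarrow> f i \<in> S"
  shows "prod f I \<in> S"
proof -
  interpret unital_subring S by fact
  show ?thesis
    using assms(2)
    by (induction I rule: infinite_finite_induct) (auto intro: one_closed mult_closed)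
qed

lemma det_in_unital_subring:
  fixes M :: "'a::comm_ring_1 mat"
  assumes S: "unital_subring S" and M: "M \<in> carrier_mat n n"
    and entries: "\<And>i j. \<lbrakk>i < n; j < n\<rbrakk> \<Longrightarrow> M $$ (i, j) \<in> S"
  shows "det M \<in> S"
proof -
  interpret unital_subring S by fact
  have "of_int (sign p) * (\<Prod>i = 0..<n. M $$ (i, p i)) \<in> S" if "p permutes {0..<n}" for p
  proof (rule mult_closed)
    show "of_int (sign p) \<in> S"
      by (auto simp: sign_def one_closed uminus_closed)
    show "(\<Prod>i = 0..<n. M $$ (i, p i)) \<in> S"
    proof (rule prod_in_unital_subring[OF S])
      fix i assume "i \<in> {0..<n}"
      then show "M $$ (i, p i) \<in> S"
        using permutes_in_image[OF that, of i] entries[of i "p i"] by simp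
    qed
  qed
  then show ?thesis
    unfolding det_def'[OF M] by (intro sum_closed) simp
qed

lemma adj_mat_in_unital_subring:
  fixes M :: "'a::comm_ring_1 mat"
  assumes S: "unital_subring S" and M: "M \<in> carrier_mat n n"
    and entries: "\<And>i j. \<lbrakk>i < n; j < n\<rbrakk> \<Longrightarrow> M $$ (i, j) \<in> S"
    and ij: "i < n" "j < n"
  shows "adj_mat M $$ (i, j) \<in> S"
proof -
  interpret unital_subring S by fact
  have "det (mat_delete M j i) \<in> S"
  proof (rule det_in_unital_subring[OF S])
    show "mat_delete M j i \<in> carrier_mat (n - 1) (n - 1)"
      using M by (rule mat_delete_carrier)
    show "mat_delete M j i $$ (k, l) \<in> S" if "k < n - 1" "l < n - 1" for k l
      using that M by (auto simp: mat_delete_def intro!: entries)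
  qed
  then show ?thesis
    using M ij
    by (auto simp: adj_mat_def cofactor_def intro!: mult_closed power_closed uminus_closed one_closed)
qed

section \<open>The Vandermonde determinant\<close>

lemma degree_prod_linear_le:
  fixes a :: "nat \<Rightarrow> 'a::comm_ring_1"
  shows "Polynomial.degree (\<Prod>k<j. [:- a k, 1:]) \<le> j"
proof -
  have "Polynomial.degree (\<Prod>k<j. [:- a k, 1:]) \<le> (\<Sum>k<j. Polynomial.degree [:- a k, 1:])"
    using degree_prod_sum_le[of "{..<j}" "\<lambda>k. [:- a k, 1:]"] by (simp add: comp_def)
  then show ?thesis by simp
qed

lemma coeff_prod_linear_top:
  fixes a :: "nat \<Rightarrow> 'a::comm_ring_1"
  shows "Polynomial.coeff (\<Prod>k<j. [:- a k, 1:]) j = 1"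
proof (induction j)
  case (Suc j)
  have "Polynomial.coeff (\<Prod>k<j. [:- a k, 1:]) (Suc j) = 0"
    using degree_prod_linear_le[of a j] by (intro coeff_eq_0) simp
  then show ?case
    using Suc by (simp add: mult.commute[of _ "[:- a j, 1:]"])
qed simp

text \<open>
  Multiplication on the right by a unitriangular matrix replaces the monomials \<open>t\<^sup>j\<close> by the monic
  polynomials \<open>(t - a\<^sub>0) \<dots> (t - a\<^sub>j\<^sub>-\<^sub>1)\<close>. These vanish at \<open>a\<^sub>i\<close> for \<open>i < j\<close>, so the product is
  lower triangular and its diagonal gives the determinant. No division occurs, so the argument
  works over every commutative ring.
\<close>
lemma det_vandermonde:
  fixes a :: "nat \<Rightarrow> 'a::comm_ring_1"
  shows "det (mat n n (\<lambda>(i, j). a i ^ j)) = (\<Prod>j<n. \<Prod>i<j. a j - a i)"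
proof -
  define f where "f j = (\<Prod>k<j. [:- a k, 1:])" for j
  define V where "V = mat n n (\<lambda>(i, j). a i ^ j)"
  define U where "U = mat n n (\<lambda>(k, j). Polynomial.coeff (f j) k)"
  define L where "L = mat n n (\<lambda>(i, j). poly (f j) (a i))"
  have carr: "V \<in> carrier_mat n n" "U \<in> carrier_mat n n" "L \<in> carrier_mat n n"
    by (simp_all add: V_def U_def L_def)
  have deg: "Polynomial.degree (f j) \<le> j" for j
    unfolding f_def by (rule degree_prod_linear_le)
  have eval: "poly (f j) x = (\<Prod>k<j. x - a k)" for j x
    by (simp add: f_def poly_prod)
  have "V * U = L"
  proof (rule eq_matI)
    fix i j assume "i < dim_row L" "j < dim_col L"
    then have ij: "i < n" "j < n" by (simp_all add: L_def)
    have "(V * U) $$ (i, j) = (\<Sum>k<n. Polynomial.coeff (f j) k * a i ^ k)"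
      using ij by (simp add: V_def U_def scalar_prod_def lessThan_atLeast0 mult.commute)
    also have "\<dots> = (\<Sum>k\<le>Polynomial.degree (f j). Polynomial.coeff (f j) k * a i ^ k)"
      using deg[of j] ij by (intro sum.mono_neutral_right) (auto simp: coeff_eq_0)
    also have "\<dots> = poly (f j) (a i)"
      by (simp add: poly_altdef)
    finally show "(V * U) $$ (i, j) = L $$ (i, j)"
      using ij by (simp add: L_def)
  qed (simp_all add: V_def U_def L_def)
  then have "det L = det V * det U"
    using det_mult[OF carr(1,2)] by simp
  moreover have "det U = 1"
  proof -
    have "upper_triangular U"
      using deg by (intro upper_triangularI) (auto simp: U_def intro!: coeff_eq_0 le_less_trans[OF deg])
    then have "det U = (\<Prod>j<n. U $$ (j, j))"
      using det_upper_triangular[OF _ carr(2)] carr(2)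
      by (simp add: prod_list_diag_prod lessThan_atLeast0)
    then show ?thesis
      by (simp add: U_def f_def coeff_prod_linear_top)
  qed
  moreover have "det L = (\<Prod>j<n. L $$ (j, j))"
  proof (subst det_lower_triangular[OF _ carr(3)])
    \<comment> \<open>above the diagonal the factor with root \<open>a i\<close> occurs in \<open>f j\<close>\<close>
    fix i j :: nat assume "i < j" "j < n"
    then show "L $$ (i, j) = 0"
      by (auto simp: L_def eval intro!: prod_zero)
  next
    show "prod_list (diag_mat L) = (\<Prod>j<n. L $$ (j, j))"
      using carr(3) by (simp add: prod_list_diag_prod lessThan_atLeast0)
  qed
  ultimately show ?thesis
    by (simp add: L_def eval flip: V_def)
qed

section \<open>Newton's identities\<close>

text \<open>
  The coefficients of this series are the elementary symmetric polynomials in \<open>a 0, \<dots>, a (n - 1)\<close>,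
  up to sign.
\<close>
definition one_minus_prod :: "(nat \<Rightarrow> 'a::comm_ring_1) \<Rightarrow> nat \<Rightarrow> 'a fps" where
  "one_minus_prod a n = (\<Prod>i<n. 1 - fps_const (a i) * fps_X)"

lemma fps_geometric:
  fixes c :: "'a::comm_ring_1"
  shows "(1 - fps_const c * fps_X) * Abs_fps (\<lambda>m. c ^ Suc m) = fps_const c"
proof (rule fps_ext)
  fix m show "fps_nth ((1 - fps_const c * fps_X) * Abs_fps (\<lambda>m. c ^ Suc m)) m = fps_nth (fps_const c) m"
    by (cases m) (simp_all add: left_diff_distrib mult.assoc)
qed

text \<open>
  Logarithmic differentiation: each factor \<open>1 - a\<^sub>i t\<close> contributes \<open>- a\<^sub>i / (1 - a\<^sub>i t)\<close>, a geometric
  series, and these add up to the negative generating function of the power sums.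
\<close>
lemma deriv_one_minus_prod:
  fixes a :: "nat \<Rightarrow> 'a::comm_ring_1"
  shows "fps_deriv (one_minus_prod a n) = - one_minus_prod a n * Abs_fps (\<lambda>m. \<Sum>i<n. a i ^ Suc m)"
proof (induction n)
  case 0
  have "Abs_fps (\<lambda>m. 0) = (0 :: 'a fps)" by (simp add: fps_ext)
  then show ?case by (simp add: one_minus_prod_def)
next
  case (Suc n)
  let ?E = "one_minus_prod a n" and ?P = "Abs_fps (\<lambda>m. \<Sum>i<n. a i ^ Suc m)"
  let ?L = "1 - fps_const (a n) * fps_X" and ?G = "Abs_fps (\<lambda>m. a n ^ Suc m)"
  have E: "one_minus_prod a (Suc n) = ?E * ?L"
    by (simp add: one_minus_prod_def)
  have P: "Abs_fps (\<lambda>m. \<Sum>i<Suc n. a i ^ Suc m) = ?P + ?G"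
    by (rule fps_ext) simp
  have ring: "- (e * (l * g)) - e * p * l = - (e * l) * (p + g)" for e l p g :: "'a fps"
    by (simp add: algebra_simps)
  have deriv_L: "fps_deriv ?L = - fps_const (a n)"
    by simp
  have "fps_deriv (?E * ?L) = - (?E * fps_const (a n)) - ?E * ?P * ?L"
    unfolding fps_deriv_mult deriv_L Suc.IH by (simp del: fps_const_neg)
  also have "\<dots> = - (?E * (?L * ?G)) - ?E * ?P * ?L"
    by (simp only: fps_geometric)
  also have "\<dots> = - (?E * ?L) * (?P + ?G)"
    by (rule ring)
  finally show ?case
    by (simp only: E P)
qed

lemma one_minus_prod_nth_0: "fps_nth (one_minus_prod a n) 0 = 1"
  by (induction n) (simp_all add: one_minus_prod_def)

lemma one_minus_prod_nth_eq_0: "n < k \<Longrightarrow> fps_nth (one_minus_prod a n) k = 0"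
proof (induction n arbitrary: k)
  case 0
  then show ?case by (simp add: one_minus_prod_def)
next
  case (Suc n)
  then obtain l where l: "k = Suc l" "n < l" by (cases k) auto
  have "one_minus_prod a (Suc n) = one_minus_prod a n - one_minus_prod a n * fps_const (a n) * fps_X"
    by (simp add: one_minus_prod_def algebra_simps)
  then show ?case
    using Suc.IH[of k] Suc.IH[of l] l by simp
qed

lemma newton_identity:
  fixes a :: "nat \<Rightarrow> 'a::comm_ring_1"
  shows "of_nat (Suc m) * fps_nth (one_minus_prod a n) (Suc m) =
    - (\<Sum>k\<le>m. fps_nth (one_minus_prod a n) k * (\<Sum>i<n. a i ^ Suc (m - k)))"
proof -
  have "of_nat (Suc m) * fps_nth (one_minus_prod a n) (Suc m) =
      fps_nth (fps_deriv (one_minus_prod a n)) m"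
    by simp
  also have "\<dots> = - (\<Sum>k\<le>m. fps_nth (one_minus_prod a n) k * (\<Sum>i<n. a i ^ Suc (m - k)))"
    unfolding deriv_one_minus_prod by (simp add: fps_mult_nth atLeast0AtMost sum_negf)
  finally show ?thesis .
qed

text \<open>
  Newton's identities determine the elementary symmetric polynomials of degree at most \<open>n\<close> from
  the first \<open>n\<close> power sums, after division by integers. Beyond degree \<open>n\<close> the elementary symmetric
  polynomials vanish, and the same identities become a recursion for the power sums.
\<close>
lemma power_sums_in_unital_subring:
  fixes a :: "nat \<Rightarrow> 'a::comm_ring_1"
  assumes S: "unital_subring S"
    and divisible: "\<And>m x. of_nat (Suc m) * x \<in> S \<Longrightarrow> x \<in> S"
    and first: "\<And>m. m < n \<Longrightarrow> (\<Sum>i<n. a i ^ Suc m) \<in> S"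
  shows "(\<Sum>i<n. a i ^ Suc m) \<in> S"
proof -
  interpret unital_subring S by fact
  let ?e = "fps_nth (one_minus_prod a n)"
  let ?p = "\<lambda>m. \<Sum>i<n. a i ^ Suc m"
  have e: "?e k \<in> S" for k
  proof (induction k rule: less_induct)
    case (less k)
    show ?case
    proof (cases k)
      case 0
      then show ?thesis by (simp add: one_minus_prod_nth_0 one_closed)
    next
      case (Suc m)
      show ?thesis
      proof (cases "m < n")
        case True
        have "of_nat (Suc m) * ?e (Suc m) \<in> S"
        proof (subst newton_identity, intro uminus_closed sum_closed)
          fix k assume "k \<in> {..m}"
          then show "?e k * ?p (m - k) \<in> S"
            using True Suc by (intro mult_closed less.IH first) auto
        qed
        then show ?thesis
          unfolding Suc by (rule divisible)
      next
        case False
        then show ?thesis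
          using Suc by (simp add: one_minus_prod_nth_eq_0 zero_closed)
      qed
    qed
  qed
  show ?thesis
  proof (induction m rule: less_induct)
    case (less m)
    show ?case
    proof (cases "m < n")
      case True
      then show ?thesis by (rule first)
    next
      case False
      have "{..m} = insert 0 {1..m}" by auto
      then have "(\<Sum>k\<le>m. ?e k * ?p (m - k)) = ?p m + (\<Sum>k=1..m. ?e k * ?p (m - k))"
        by (simp add: one_minus_prod_nth_0)
      moreover have "(\<Sum>k\<le>m. ?e k * ?p (m - k)) = 0"
        using newton_identity[of m a n] one_minus_prod_nth_eq_0[of n "Suc m" a] False by simp
      ultimately have "?p m = - (\<Sum>k=1..m. ?e k * ?p (m - k))"
        by (simp add: add_eq_0_iff2)
      also have "\<dots> \<in> S"
      proof (intro uminus_closed sum_closed)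
        fix k assume "k \<in> {1..m}"
        then show "?e k * ?p (m - k) \<in> S"
          by (intro mult_closed less.IH e) auto
      qed
      finally show ?thesis .
    qed
  qed
qed

section \<open>Polynomials in finitely many variables\<close>

lemma poly_mapping_additive_induct [case_names single add]:
  fixes p :: "'m \<Rightarrow>\<^sub>0 'c::comm_monoid_add"
  assumes single: "\<And>m c. P (Poly_Mapping.single m c)"
    and add: "\<And>p q. \<lbrakk>P p; P q\<rbrakk> \<Longrightarrow> P (p + q)"
  shows "P p"
proof (induction p rule: update_induct)
  case const
  show ?case using single[of undefined 0] by simp
next
  case (update p m c)
  have "Poly_Mapping.update m c p = p + Poly_Mapping.single m c"
    using update(1) by (intro poly_mapping_eqI)
      (auto simp: lookup_update lookup_add lookup_single when_def in_keys_iff)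
  then show ?case using update add single by metis
qed

text \<open>
  Substitution of values for variables and the action of a free algebra are both defined as sums
  over the support of an element. This is their common additivity; the support of a sum may be
  smaller than the union of the supports, which is harmless since zero coefficients contribute
  nothing.
\<close>
lemma sum_keys_add:
  fixes h :: "'m \<Rightarrow> 'c::comm_monoid_add \<Rightarrow> 'b::comm_monoid_add"
  assumes h0: "\<And>m. h m 0 = 0" and h_add: "\<And>m a b. h m (a + b) = h m a + h m b"
  shows "(\<Sum>m\<in>Poly_Mapping.keys (p + q). h m (Poly_Mapping.lookup (p + q) m)) =
    (\<Sum>m\<in>Poly_Mapping.keys p. h m (Poly_Mapping.lookup p m)) +
    (\<Sum>m\<in>Poly_Mapping.keys q. h m (Poly_Mapping.lookup q m))"
proof -
  let ?K = "Poly_Mapping.keys p \<union> Poly_Mapping.keys q"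
  have sup: "(\<Sum>m\<in>Poly_Mapping.keys r. h m (Poly_Mapping.lookup r m)) =
      (\<Sum>m\<in>?K. h m (Poly_Mapping.lookup r m))" if "Poly_Mapping.keys r \<subseteq> ?K" for r
    using that by (intro sum.mono_neutral_left) (auto simp: in_keys_iff h0)
  show ?thesis
    unfolding sup[OF Poly_Mapping.keys_add] sup[OF Un_upper1] sup[OF Un_upper2]
    by (simp add: lookup_add h_add sum.distrib)
qed

lemma const_mult: "const (a * b) = (const a * const b :: 'm::monoid_add \<Rightarrow>\<^sub>0 complex)"
  by (simp add: mult_single)

lemma of_nat_eq_const: "of_nat k = (const (of_nat k) :: 'm::monoid_add \<Rightarrow>\<^sub>0 complex)"
  by (induction k) (simp_all add: single_add add.commute)

lemma subst_poly_add: "subst_poly n v (p + q) = subst_poly n v p + subst_poly n v q"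
  unfolding subst_poly_def by (rule sum_keys_add) (simp_all add: single_add distrib_right)

lemma subst_poly_single:
  "subst_poly n v (Poly_Mapping.single m c) =
     const c * prod_list (map (\<lambda>j. v j ^ Poly_Mapping.lookup m j) [0..<n])"
  by (cases "c = 0") (simp_all add: subst_poly_def)

lemma subst_poly_single_commutative:
  fixes v :: "nat \<Rightarrow> ('m::comm_monoid_add \<Rightarrow>\<^sub>0 complex)"
  shows "subst_poly n v (Poly_Mapping.single m c) = const c * (\<Prod>j<n. v j ^ Poly_Mapping.lookup m j)"
  by (simp add: subst_poly_single lessThan_atLeast0 flip: prod.distinct_set_conv_list)

lemma subst_poly_mult:
  fixes v :: "nat \<Rightarrow> ('m::comm_monoid_add \<Rightarrow>\<^sub>0 complex)"
  shows "subst_poly n v (p * q) = subst_poly n v p * subst_poly n v q"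
proof (induction p rule: poly_mapping_additive_induct)
  case (single m c)
  show ?case
  proof (induction q rule: poly_mapping_additive_induct)
    case (single m' c')
    have "Poly_Mapping.single m c * Poly_Mapping.single m' c' = Poly_Mapping.single (m + m') (c * c')"
      by (rule mult_single)
    then show ?case
      by (simp only: subst_poly_single_commutative lookup_add power_add prod.distrib const_mult mult_ac)
  qed (simp add: subst_poly_add distrib_left)
qed (simp add: subst_poly_add distrib_right)

lemma subst_poly_const:
  fixes v :: "nat \<Rightarrow> ('m::comm_monoid_add \<Rightarrow>\<^sub>0 complex)"
  shows "subst_poly n v (const c) = const c"
  by (simp add: subst_poly_single_commutative)

lemma subst_poly_diff: "subst_poly n v (p - q) = subst_poly n v p - subst_poly n v q"
  using subst_poly_add[of n v "p - q" q] by simp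

lemma subst_poly_X:
  fixes v :: "nat \<Rightarrow> ('m::comm_monoid_add \<Rightarrow>\<^sub>0 complex)"
  assumes "j < n"
  shows "subst_poly n v (X j) = v j"
proof -
  have "(\<Prod>k<n. v k ^ Poly_Mapping.lookup (Poly_Mapping.single j 1) k) = (\<Prod>k<n. if k = j then v j else 1)"
    by (rule prod.cong) (auto simp: lookup_single)
  then show ?thesis
    using assms by (simp add: X_def subst_poly_single_commutative)
qed

lemma unital_subring_polys_in: "unital_subring (polys_in n)"
proof
  show "1 \<in> polys_in n" by (simp add: polys_in_def)
next
  fix p q assume pq: "p \<in> polys_in n" "q \<in> polys_in n"
  show "p - q \<in> polys_in n"
    using pq Poly_Mapping.keys_diff[of p q] unfolding polys_in_def by blast
  have "Poly_Mapping.keys m \<subseteq> {..<n}" if m: "m \<in> Poly_Mapping.keys (p * q)" for m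
  proof -
    obtain a b where "m = a + b" "a \<in> Poly_Mapping.keys p" "b \<in> Poly_Mapping.keys q"
      using m Poly_Mapping.keys_mult[of p q] by blast
    then show ?thesis
      using pq Poly_Mapping.keys_add[of a b] unfolding polys_in_def by blast
  qed
  then show "p * q \<in> polys_in n" by (simp add: polys_in_def)
qed

lemma const_in_polys_in: "const c \<in> polys_in n"
  by (simp add: polys_in_def)

lemma X_in_polys_in: "i < n \<Longrightarrow> X i \<in> polys_in n"
  by (simp add: polys_in_def X_def)

lemma dpoly_in_polys_in:
  assumes "p \<in> polys_in n"
  shows "dpoly i p \<in> polys_in n"
  unfolding dpoly_def
proof (rule unital_subring.sum_closed[OF unital_subring_polys_in])
  fix m assume "m \<in> Poly_Mapping.keys p"
  then have "Poly_Mapping.keys m \<subseteq> {..<n}"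
    using assms by (simp add: polys_in_def)
  moreover have "Poly_Mapping.keys (m - Poly_Mapping.single i 1) \<subseteq> Poly_Mapping.keys m"
    by (auto simp: in_keys_iff lookup_minus)
  ultimately have "Poly_Mapping.keys (m - Poly_Mapping.single i 1) \<subseteq> {..<n}"
    by blast
  then show "Poly_Mapping.single (m - Poly_Mapping.single i 1)
      (of_nat (Poly_Mapping.lookup m i) * Poly_Mapping.lookup p m) \<in> polys_in n"
    by (simp add: polys_in_def)
qed

lemma dpoly_const: "dpoly i (const c) = 0"
  by (simp add: dpoly_single)

lemma dpoly_X: "dpoly i (X k) = (if i = k then 1 else 0)"
  by (simp add: X_def dpoly_single lookup_single when_def)

lemma dpoly_power: "dpoly i (p ^ k) = of_nat k * p ^ (k - 1) * dpoly i p"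
proof (induction k)
  case 0
  show ?case using dpoly_const[of i 1] by simp
next
  case (Suc k)
  then show ?case
    by (cases k) (simp_all add: dpoly_mult algebra_simps)
qed

lemma dpoly_commute: "dpoly i (dpoly j p) = dpoly j (dpoly i p)"
proof (induction p rule: poly_mapping_additive_induct)
  case (single m c)
  have "m - Poly_Mapping.single j 1 - Poly_Mapping.single i 1 =
      m - Poly_Mapping.single i 1 - Poly_Mapping.single j (1::nat)"
    by (rule poly_mapping_eqI) (simp add: lookup_minus)
  then show ?case
    by (cases "i = j") (auto simp: dpoly_single lookup_minus lookup_single mult_ac)
qed (simp add: dpoly_add)

section \<open>The Jacobian matrix and its determinant\<close>

definition jacobian :: "nat \<Rightarrow> cpoly mat" where
  "jacobian n = mat n n (\<lambda>(i, j). of_nat (2 * Suc j) * X i ^ (2 * Suc j - 1))"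

lemma jacobian_carrier: "jacobian n \<in> carrier_mat n n"
  by (simp add: jacobian_def)

lemma dpoly_Y:
  assumes "i < n" "j < n"
  shows "dpoly i (Y n j) = jacobian n $$ (i, j)"
proof -
  have "dpoly i (Y n j) = (\<Sum>k<n. if k = i then of_nat (2 * Suc j) * X i ^ (2 * Suc j - 1) else 0)"
    unfolding Y_def dpoly_sum dpoly_power dpoly_X by (rule sum.cong) auto
  also have "\<dots> = of_nat (2 * Suc j) * X i ^ (2 * Suc j - 1)"
    using assms by simp
  finally show ?thesis
    using assms by (simp add: jacobian_def)
qed

lemma prod_even_numbers: "(\<Prod>j<n. of_nat (2 * Suc j)) = (2 ^ n * fact n :: cpoly)"
  by (induction n) (simp_all add: mult_ac)

text \<open>
  The entry in row \<open>i\<close> and column \<open>j\<close> is \<open>x\<^sub>i \<cdot> (x\<^sub>i\<^sup>2)\<^sup>j \<cdot> 2(j + 1)\<close>, with columns counted from 0, so the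
  matrix is a Vandermonde matrix in the squares multiplied by a diagonal matrix on either side.
\<close>
lemma det_jacobian: "det (jacobian n) = Delta n"
proof -
  define V where "V = mat n n (\<lambda>(i, j). (X i ^ 2) ^ j)"
  define B where "B = mat_diag n X"
  define C where "C = mat_diag n (\<lambda>j. of_nat (2 * Suc j) :: cpoly)"
  have carr: "V \<in> carrier_mat n n" "B \<in> carrier_mat n n" "C \<in> carrier_mat n n"
    by (simp_all add: V_def B_def C_def)
  have det_diag: "det (mat_diag n f) = (\<Prod>i<n. f i)" for f :: "nat \<Rightarrow> cpoly"
    by (subst det_upper_triangular[of _ n])
      (auto simp: mat_diag_def prod_list_diag_prod lessThan_atLeast0 intro!: upper_triangularI)
  have BV: "B * V = mat n n (\<lambda>(i, j). X i * (X i ^ 2) ^ j)"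
    unfolding B_def mat_diag_mult_left[OF carr(1)] by (rule eq_matI) (auto simp: V_def)
  have "jacobian n = B * V * C"
    unfolding BV C_def
    by (subst mat_diag_mult_right[of _ n])
      (auto simp: jacobian_def power_mult[symmetric] power_Suc[symmetric] mult.commute intro!: eq_matI
        simp del: power_Suc)
  then have "det (jacobian n) = det B * det V * det C"
    using carr by (simp add: det_mult[of _ n])
  then show ?thesis
    unfolding B_def C_def V_def det_diag det_vandermonde prod_even_numbers Delta_def
    by (simp add: mult_ac)
qed

lemma jacobian_in_polys_in:
  assumes "i < n" "j < n"
  shows "jacobian n $$ (i, j) \<in> polys_in n"
proof -
  have "of_nat (2 * Suc j) * X i ^ (2 * Suc j - 1) \<in> polys_in n"
    using assms(1)
    by (intro unital_subring.mult_closed[OF unital_subring_polys_in]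
        unital_subring.of_nat_closed[OF unital_subring_polys_in]
        unital_subring.power_closed[OF unital_subring_polys_in] X_in_polys_in)
  then show ?thesis
    using assms by (simp only: jacobian_def index_mat prod.case)
qed

lemma Delta_in_polys_in: "Delta n \<in> polys_in n"
  unfolding det_jacobian[symmetric]
  by (rule det_in_unital_subring[OF unital_subring_polys_in jacobian_carrier jacobian_in_polys_in])

lemma X_power2_neq:
  assumes "i \<noteq> j"
  shows "X i ^ 2 \<noteq> X j ^ 2"
proof
  assume eq: "X i ^ 2 = X j ^ 2"
  have "X k ^ 2 = Poly_Mapping.single (Poly_Mapping.single k 2) 1" for k
    by (simp add: X_def numeral_2_eq_2 mult_single flip: single_add)
  then have "Poly_Mapping.lookup (X k ^ 2) (Poly_Mapping.single i 2) = (if k = i then 1 else 0)" for k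
    by (metis lookup_single_eq lookup_single_not_eq zero_neq_numeral)
  then show False
    using eq assms by (metis zero_neq_one)
qed

lemma Delta_nonzero: "Delta n \<noteq> 0"
proof -
  have "X i \<noteq> 0" for i
    by (metis X_def lookup_single_eq lookup_zero zero_neq_one)
  then show ?thesis
    by (auto simp: Delta_def X_power2_neq)
qed

section \<open>The discriminant as a polynomial in the invariants\<close>

text \<open>
  The polynomials in the \<open>y\<^sub>j\<close> form a subring, so it suffices to find a matrix with determinant
  \<open>\<Delta>\<^sup>2\<close> and entries in this subring. The Gram matrix of the columns of the Jacobian is such a
  matrix, because its entries are integer multiples of power sums of the \<open>x\<^sub>i\<^sup>2\<close>.
\<close>
lemma Delta_square_polynomial_in_Y:
  "\<exists>P \<in> polys_in n. subst_poly n (Y n) P = Delta n ^ 2"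
proof -
  define S where "S = subst_poly n (Y n) ` polys_in n"
  have S: "unital_subring S"
  proof
    have "subst_poly n (Y n) 1 = 1"
      using subst_poly_const[of n "Y n" 1] by simp
    then show "1 \<in> S"
      unfolding S_def by (metis image_eqI unital_subring.one_closed[OF unital_subring_polys_in])
  next
    fix p q assume "p \<in> S" "q \<in> S"
    then obtain p' q' where pq: "p' \<in> polys_in n" "q' \<in> polys_in n"
        "p = subst_poly n (Y n) p'" "q = subst_poly n (Y n) q'"
      by (auto simp: S_def)
    show "p - q \<in> S"
      using pq unital_subring.diff_closed[OF unital_subring_polys_in pq(1,2)]
      by (auto simp: S_def subst_poly_diff[symmetric])
    show "p * q \<in> S"
      using pq unital_subring.mult_closed[OF unital_subring_polys_in pq(1,2)]
      by (auto simp: S_def subst_poly_mult[symmetric])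
  qed
  have const: "const c \<in> S" for c
    unfolding S_def by (metis image_eqI const_in_polys_in subst_poly_const)
  have power_sum: "(\<Sum>i<n. (X i ^ 2) ^ Suc m) \<in> S" for m
  proof (rule power_sums_in_unital_subring[OF S])
    fix k and x :: cpoly assume "of_nat (Suc k) * x \<in> S"
    then have "const (1 / of_nat (Suc k)) * (of_nat (Suc k) * x) \<in> S"
      by (rule unital_subring.mult_closed[OF S const])
    moreover have "const (1 / of_nat (Suc k)) * of_nat (Suc k) = (1 :: cpoly)"
      unfolding of_nat_eq_const const_mult[symmetric] by (simp del: of_nat_Suc)
    ultimately show "x \<in> S"
      by (simp only: mult.assoc[symmetric] mult_1_left)
  next
    fix m assume "m < n"
    then have "Y n m \<in> S"
      unfolding S_def by (metis image_eqI subst_poly_X X_in_polys_in)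
    then show "(\<Sum>i<n. (X i ^ 2) ^ Suc m) \<in> S"
      by (simp only: Y_def power_mult)
  qed
  let ?J = "jacobian n"
  have J: "transpose_mat ?J * ?J \<in> carrier_mat n n"
    using jacobian_carrier[of n] by auto
  have "Delta n ^ 2 = det (transpose_mat ?J * ?J)"
    using jacobian_carrier[of n]
    by (simp add: det_mult[of _ n] det_transpose det_jacobian power2_eq_square)
  also have "\<dots> \<in> S"
  proof (rule det_in_unital_subring[OF S J])
    fix j k assume jk: "j < n" "k < n"
    have "(transpose_mat ?J * ?J) $$ (j, k) = (\<Sum>i<n. ?J $$ (i, j) * ?J $$ (i, k))"
      using jacobian_carrier[of n] jk by (auto simp: scalar_prod_def lessThan_atLeast0)
    also have "\<dots> = of_nat (2 * Suc j) * of_nat (2 * Suc k) * (\<Sum>i<n. (X i ^ 2) ^ Suc (j + k))"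
      unfolding sum_distrib_left
    proof (rule sum.cong)
      fix i assume i: "i \<in> {..<n}"
      have "X i ^ (2 * Suc j - 1) * X i ^ (2 * Suc k - 1) = (X i ^ 2) ^ Suc (j + k)"
        by (simp flip: power_add power_mult)
      then show "?J $$ (i, j) * ?J $$ (i, k) =
          of_nat (2 * Suc j) * of_nat (2 * Suc k) * (X i ^ 2) ^ Suc (j + k)"
        using i jk by (simp add: jacobian_def mult_ac)
    qed simp
    also have "\<dots> \<in> S"
      by (intro unital_subring.mult_closed[OF S] unital_subring.of_nat_closed[OF S] power_sum)
    finally show "(transpose_mat ?J * ?J) $$ (j, k) \<in> S" .
  qed
  finally show ?thesis
    by (auto simp: S_def)
qed

lemma Delta_sq_poly_spec:
  "Delta_sq_poly n \<in> polys_in n" "subst_poly n (Y n) (Delta_sq_poly n) = Delta n ^ 2"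
  using someI_ex[OF Delta_square_polynomial_in_Y[of n, unfolded Bex_def]]
  by (auto simp: Delta_sq_poly_def)

section \<open>Differentiation of rational functions\<close>

lemma comm_ring_hom_of_cpoly: "comm_ring_hom of_cpoly"
  by standard (simp_all add: Zero_fract_def One_fract_def)

lemma of_cpoly_0: "of_cpoly 0 = 0"
  by (simp add: Zero_fract_def)

lemma of_cpoly_1: "of_cpoly 1 = 1"
  by (simp add: One_fract_def)

lemma drat_of_cpoly: "drat i (of_cpoly p) = of_cpoly (dpoly i p)"
  using dpoly_const[of i 1] by (simp add: drat_Fract)

lemma drat_const: "drat i (of_cpoly (const c)) = 0"
  by (simp add: drat_of_cpoly dpoly_const of_cpoly_0)

lemma drat_add: "drat i (f + g) = drat i f + drat i g"
proof (cases f)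
  case f: (Fract a b)
  show ?thesis
  proof (cases g)
    case g: (Fract c d)
    show ?thesis
      using f(2) g(2) unfolding f(1) g(1)
      by (simp add: drat_Fract eq_fract dpoly_add dpoly_mult algebra_simps)
  qed
qed

lemma drat_mult: "drat i (f * g) = drat i f * g + f * drat i g"
proof (cases f)
  case f: (Fract a b)
  show ?thesis
  proof (cases g)
    case g: (Fract c d)
    show ?thesis
      using f(2) g(2) unfolding f(1) g(1)
      by (simp add: drat_Fract eq_fract dpoly_add dpoly_mult algebra_simps)
  qed
qed

text \<open>
  On polynomials partial derivatives commute. For a quotient \<open>f = a / b\<close>, both iterated derivatives
  of \<open>f b = a\<close> expand by the Leibniz rule into the same terms, except for the second derivative of
  \<open>f\<close> itself, and \<open>b\<close> can be cancelled.
\<close>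
lemma drat_commute: "drat i (drat j f) = drat j (drat i f)"
proof (cases f)
  case (Fract a b)
  let ?b = "of_cpoly b"
  have b: "?b \<noteq> 0"
    using Fract(2) by (simp add: Zero_fract_def eq_fract)
  have fb: "f * ?b = of_cpoly a"
    using Fract by (simp add: eq_fract)
  have second: "drat k (drat l f) * ?b + drat l f * drat k ?b + (drat k f * drat l ?b + f * drat k (drat l ?b))
      = of_cpoly (dpoly k (dpoly l a))" for k l
    using arg_cong[OF fb, of "\<lambda>g. drat k (drat l g)"]
    by (simp only: drat_mult drat_add drat_of_cpoly)
  let ?rest = "drat i f * drat j ?b + (drat j f * drat i ?b + f * drat i (drat j ?b))"
  have "drat i (drat j f) * ?b + ?rest = of_cpoly (dpoly i (dpoly j a))"
    using second[of i j] by (simp only: add_ac)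
  moreover have "drat j (drat i f) * ?b + ?rest = of_cpoly (dpoly i (dpoly j a))"
    using second[of j i] by (simp only: drat_of_cpoly dpoly_commute[of j i] add_ac)
  ultimately have "drat i (drat j f) * ?b = drat j (drat i f) * ?b"
    by (metis add_right_cancel)
  then show ?thesis using b by simp
qed

section \<open>The coordinate ring of the complement of the discriminant\<close>

lemma of_cpoly_Delta_nonzero: "of_cpoly (Delta n) \<noteq> 0"
  using Delta_nonzero by (simp add: Zero_fract_def eq_fract)

lemma OX_memI: "p \<in> polys_in n \<Longrightarrow> Fraction_Field.Fract p (Delta n ^ k) \<in> OX n"
  by (auto simp: OX_def)

lemma of_cpoly_in_OX: "p \<in> polys_in n \<Longrightarrow> of_cpoly p \<in> OX n"
  using OX_memI[of p n 0] by simp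

lemma inverse_Delta_in_OX: "inverse (of_cpoly (Delta n)) \<in> OX n"
  using OX_memI[OF unital_subring.one_closed[OF unital_subring_polys_in], of n 1] by simp

lemma unital_subring_OX: "unital_subring (OX n)"
proof
  show "1 \<in> OX n"
    using of_cpoly_in_OX[OF unital_subring.one_closed[OF unital_subring_polys_in]] by (simp add: of_cpoly_1)
next
  fix f g assume "f \<in> OX n" "g \<in> OX n"
  then obtain p k q l where f: "f = Fraction_Field.Fract p (Delta n ^ k)" "p \<in> polys_in n"
    and g: "g = Fraction_Field.Fract q (Delta n ^ l)" "q \<in> polys_in n"
    by (auto simp: OX_def)
  have "f - g = Fraction_Field.Fract (p * Delta n ^ l - q * Delta n ^ k) (Delta n ^ (k + l))"
    using Delta_nonzero by (simp add: f g power_add)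
  also have "\<dots> \<in> OX n"
    by (intro OX_memI unital_subring.mult_closed[OF unital_subring_polys_in]
        unital_subring.diff_closed[OF unital_subring_polys_in]
        unital_subring.power_closed[OF unital_subring_polys_in] Delta_in_polys_in f(2) g(2))
  finally show "f - g \<in> OX n" .
  have "f * g = Fraction_Field.Fract (p * q) (Delta n ^ (k + l))"
    by (simp add: f g power_add)
  also have "\<dots> \<in> OX n"
    by (intro OX_memI unital_subring.mult_closed[OF unital_subring_polys_in] f(2) g(2))
  finally show "f * g \<in> OX n" .
qed

lemma drat_in_OX:
  assumes "f \<in> OX n"
  shows "drat i f \<in> OX n"
proof -
  obtain p k where f: "f = Fraction_Field.Fract p (Delta n ^ k)" "p \<in> polys_in n"
    using assms by (auto simp: OX_def)
  let ?q = "dpoly i p * Delta n ^ k - p * dpoly i (Delta n ^ k)"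
  have "?q \<in> polys_in n"
    by (intro unital_subring.mult_closed[OF unital_subring_polys_in]
        unital_subring.diff_closed[OF unital_subring_polys_in]
        unital_subring.power_closed[OF unital_subring_polys_in] Delta_in_polys_in dpoly_in_polys_in f(2))
  moreover have "drat i f = Fraction_Field.Fract ?q (Delta n ^ (k + k))"
    using Delta_nonzero by (simp add: f(1) drat_Fract power_add)
  ultimately show ?thesis
    by (simp only: OX_memI)
qed

section \<open>The inverse Jacobian and the vector fields dual to the invariants\<close>

definition A_inverse :: "nat \<Rightarrow> crat mat" where
  "A_inverse n = inverse (of_cpoly (Delta n)) \<cdot>\<^sub>m map_mat of_cpoly (adj_mat (jacobian n))"

lemma A_mat_eq_jacobian: "A_mat n = map_mat of_cpoly (jacobian n)"
  by (rule eq_matI) (simp_all add: A_mat_def jacobian_def)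

lemma A_mat_carrier: "A_mat n \<in> carrier_mat n n"
  by (simp add: A_mat_def)

lemma A_inverse_carrier: "A_inverse n \<in> carrier_mat n n"
  using adj_mat(1)[OF jacobian_carrier] by (simp add: A_inverse_def)

lemma A_mat_inverse: "A_mat n * A_inverse n = 1\<^sub>m n" "A_inverse n * A_mat n = 1\<^sub>m n"
proof -
  let ?J = "jacobian n" and ?d = "of_cpoly (Delta n)"
  note hom_mult = semiring_hom.mat_hom_mult[OF ring_hom.axioms(1)[OF comm_ring_hom.axioms[OF comm_ring_hom_of_cpoly]]]
  let ?M = "map_mat of_cpoly ?J" and ?N = "map_mat of_cpoly (adj_mat ?J)"
  note adj = adj_mat[OF jacobian_carrier[of n], unfolded det_jacobian]
  have carr: "?M \<in> carrier_mat n n" "?N \<in> carrier_mat n n"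
    using jacobian_carrier[of n] adj(1) by simp_all
  have scalar: "map_mat of_cpoly (Delta n \<cdot>\<^sub>m 1\<^sub>m n) = ?d \<cdot>\<^sub>m 1\<^sub>m n"
    by (rule eq_matI) (auto simp: Zero_fract_def)
  have unit: "inverse ?d \<cdot>\<^sub>m (?d \<cdot>\<^sub>m 1\<^sub>m n) = 1\<^sub>m n"
    using left_inverse[OF of_cpoly_Delta_nonzero[of n]]
    by (intro eq_matI) (auto simp del: inverse_fract mult_fract)
  have "?M * ?N = ?d \<cdot>\<^sub>m 1\<^sub>m n"
    using hom_mult[OF jacobian_carrier adj(1)] adj(2) scalar by simp
  then show "A_mat n * A_inverse n = 1\<^sub>m n"
    by (simp only: A_mat_eq_jacobian A_inverse_def mult_smult_distrib[OF carr] unit)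
  have "?N * ?M = ?d \<cdot>\<^sub>m 1\<^sub>m n"
    using hom_mult[OF adj(1) jacobian_carrier] adj(3) scalar by simp
  then show "A_inverse n * A_mat n = 1\<^sub>m n"
    by (simp only: A_mat_eq_jacobian A_inverse_def mult_smult_assoc_mat[OF carr(2,1)] unit)
qed

lemma A_inverse_in_OX:
  assumes "i < n" "j < n"
  shows "A_inverse n $$ (i, j) \<in> OX n"
proof -
  have "adj_mat (jacobian n) $$ (i, j) \<in> polys_in n"
    by (rule adj_mat_in_unital_subring[OF unital_subring_polys_in jacobian_carrier
          jacobian_in_polys_in assms])
  then have "inverse (of_cpoly (Delta n)) * of_cpoly (adj_mat (jacobian n) $$ (i, j)) \<in> OX n"
    by (intro unital_subring.mult_closed[OF unital_subring_OX] inverse_Delta_in_OX of_cpoly_in_OX)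
  then show ?thesis
    using assms adj_mat(1)[OF jacobian_carrier[of n]] by (simp add: A_inverse_def)
qed

lemma A_mat_A_inverse_sum:
  assumes "i < n" "m < n"
  shows "(\<Sum>l<n. A_mat n $$ (i, l) * A_inverse n $$ (l, m)) = (if i = m then 1 else 0)"
proof -
  have "(A_mat n * A_inverse n) $$ (i, m) = (\<Sum>l<n. A_mat n $$ (i, l) * A_inverse n $$ (l, m))"
    using assms A_mat_carrier[of n] A_inverse_carrier[of n]
    by (auto simp: scalar_prod_def lessThan_atLeast0)
  then show ?thesis
    using assms by (simp add: A_mat_inverse)
qed

lemma A_inverse_A_mat_sum:
  assumes "i < n" "m < n"
  shows "(\<Sum>l<n. A_inverse n $$ (i, l) * A_mat n $$ (l, m)) = (if i = m then 1 else 0)"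
proof -
  have "(A_inverse n * A_mat n) $$ (i, m) = (\<Sum>l<n. A_inverse n $$ (i, l) * A_mat n $$ (l, m))"
    using assms A_mat_carrier[of n] A_inverse_carrier[of n]
    by (auto simp: scalar_prod_def lessThan_atLeast0)
  then show ?thesis
    using assms by (simp add: A_mat_inverse)
qed

lemma A_mat_eq_drat_Y:
  assumes "i < n" "j < n"
  shows "A_mat n $$ (i, j) = drat i (of_cpoly (Y n j))"
  using assms jacobian_carrier[of n]
  by (simp add: A_mat_eq_jacobian drat_of_cpoly dpoly_Y)

text \<open>
  The sum makes sense for every \<open>j\<close>, so it defines a derivation of the field of rational functions
  even where the index exceeds the size of the matrix; only \<open>j < n\<close> gives \<open>\<partial>/\<partial>y\<^sub>j\<close>.
\<close>
definition dy :: "nat \<Rightarrow> nat \<Rightarrow> crat \<Rightarrow> crat" where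
  "dy n j f = (\<Sum>i<n. A_inverse n $$ (j, i) * drat i f)"

lemma dy_add: "dy n j (f + g) = dy n j f + dy n j g"
  by (simp add: dy_def drat_add distrib_left sum.distrib)

lemma dy_mult: "dy n j (f * g) = dy n j f * g + f * dy n j g"
  by (simp add: dy_def drat_mult distrib_left sum.distrib sum_distrib_left sum_distrib_right mult_ac)

lemma dy_const: "dy n j (of_cpoly (const c)) = 0"
  by (simp add: dy_def drat_const)

lemma dy_sum: "dy n j (sum f I) = (\<Sum>i\<in>I. dy n j (f i))"
proof -
  have "dy n j 0 = 0" using dy_const[of n j 0] by (simp add: of_cpoly_0)
  then show ?thesis
    by (induction I rule: infinite_finite_induct) (simp_all add: dy_add)
qed

lemma dy_in_OX: "\<lbrakk>j < n; f \<in> OX n\<rbrakk> \<Longrightarrow> dy n j f \<in> OX n"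
  unfolding dy_def
  by (intro unital_subring.sum_closed[OF unital_subring_OX]
      unital_subring.mult_closed[OF unital_subring_OX] A_inverse_in_OX drat_in_OX) simp_all

lemma dy_Y:
  assumes "j < n" "k < n"
  shows "dy n j (of_cpoly (Y n k)) = (if j = k then 1 else 0)"
  unfolding dy_def using A_inverse_A_mat_sum[OF assms] assms
  by (simp add: A_mat_eq_drat_Y)

text \<open>
  In the commutator the second order terms cancel by symmetry, so it is a first order operator
  \<open>\<Sum>\<^sub>i c\<^sub>i \<partial>/\<partial>x\<^sub>i\<close>. Applied to \<open>y\<^sub>l\<close> it gives 0, since the first derivatives of \<open>y\<^sub>l\<close> are constants;
  thus the row vector \<open>c\<close> is annihilated by \<open>A\<close>, which forces \<open>c = 0\<close>.
\<close>
lemma dy_commute: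
  assumes jk: "j < n" "k < n"
  shows "dy n j (dy n k f) = dy n k (dy n j f)"
proof -
  let ?B = "\<lambda>j i. A_inverse n $$ (j, i)"
  define c where "c i = dy n j (?B k i) - dy n k (?B j i)" for i
  have expand: "dy n a (dy n b g) =
      (\<Sum>i<n. dy n a (?B b i) * drat i g) + (\<Sum>i<n. \<Sum>l<n. ?B b i * ?B a l * drat l (drat i g))" for a b g
  proof -
    have "dy n a (dy n b g) = (\<Sum>i<n. dy n a (?B b i) * drat i g + ?B b i * dy n a (drat i g))"
      unfolding dy_def[of n b] dy_sum dy_mult ..
    then show ?thesis
      by (simp add: sum.distrib dy_def[of n a "drat _ g"] sum_distrib_left mult.assoc)
  qed
  have commutator: "dy n j (dy n k g) - dy n k (dy n j g) = (\<Sum>i<n. c i * drat i g)" for g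
  proof -
    have "(\<Sum>i<n. \<Sum>l<n. ?B k i * ?B j l * drat l (drat i g)) =
        (\<Sum>i<n. \<Sum>l<n. ?B j i * ?B k l * drat l (drat i g))"
      by (subst sum.swap) (simp add: mult_ac drat_commute)
    then show ?thesis
      by (simp add: expand c_def left_diff_distrib sum_subtractf)
  qed
  have kills_Y: "(\<Sum>i<n. c i * A_mat n $$ (i, l)) = 0" if l: "l < n" for l
  proof -
    have const: "dy n a (if P then 1 else 0) = 0" for a P
      using dy_const[of n a 0] dy_const[of n a 1] by (simp add: of_cpoly_0 of_cpoly_1)
    have "dy n j (dy n k (of_cpoly (Y n l))) - dy n k (dy n j (of_cpoly (Y n l))) = 0"
      unfolding dy_Y[OF jk(1) l] dy_Y[OF jk(2) l] const by simp
    then show ?thesis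
      using l by (simp add: commutator A_mat_eq_drat_Y)
  qed
  have "c m = 0" if m: "m < n" for m
  proof -
    have "c m = (\<Sum>i<n. c i * (\<Sum>l<n. A_mat n $$ (i, l) * ?B l m))"
      using m by (simp add: A_mat_A_inverse_sum if_distrib[of "\<lambda>x. _ * x"] cong: if_cong)
    also have "\<dots> = (\<Sum>l<n. (\<Sum>i<n. c i * A_mat n $$ (i, l)) * ?B l m)"
      unfolding sum_distrib_left sum_distrib_right by (subst sum.swap) (simp add: mult.assoc)
    also have "\<dots> = 0"
      by (simp add: kills_Y)
    finally show ?thesis .
  qed
  then show ?thesis
    using commutator[of f] by simp
qed

section \<open>Left modules over quotient rings\<close>

text \<open>
  Two module records with scalars of different types have different types, so they can only be
  compared through their additive structure.
\<close>
lemma abelian_group_cong: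
  assumes M: "abelian_group M"
    and eq: "carrier N = carrier M" "add N = add M" "zero N = zero M"
  shows "abelian_group N"
proof -
  interpret M: abelian_group M by (rule M)
  show ?thesis
  proof (rule abelian_groupI)
    fix x assume "x \<in> carrier N"
    then show "\<exists>y\<in>carrier N. y \<oplus>\<^bsub>N\<^esub> x = \<zero>\<^bsub>N\<^esub>"
      using M.l_neg M.a_inv_closed by (auto simp: eq)
  qed (auto simp: eq M.a_ac)
qed

context left_module
begin

lemma smult_zero_right:
  assumes a: "a \<in> carrier R"
  shows "a \<odot>\<^bsub>M\<^esub> \<zero>\<^bsub>M\<^esub> = \<zero>\<^bsub>M\<^esub>"
proof -
  let ?z = "a \<odot>\<^bsub>M\<^esub> \<zero>\<^bsub>M\<^esub>"
  have z: "?z \<in> carrier M" using a by (simp add: smult_closed)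
  then have "?z \<oplus>\<^bsub>M\<^esub> ?z = ?z \<oplus>\<^bsub>M\<^esub> \<zero>\<^bsub>M\<^esub>"
    using a smult_r_distr[of a "\<zero>\<^bsub>M\<^esub>" "\<zero>\<^bsub>M\<^esub>"] by (metis M.r_zero M.zero_closed)
  then show ?thesis
    using z by (metis M.add.l_cancel_one M.r_zero)
qed

lemma smult_zero_left:
  assumes x: "x \<in> carrier M"
  shows "\<zero>\<^bsub>R\<^esub> \<odot>\<^bsub>M\<^esub> x = \<zero>\<^bsub>M\<^esub>"
proof -
  let ?z = "\<zero>\<^bsub>R\<^esub> \<odot>\<^bsub>M\<^esub> x"
  have z: "?z \<in> carrier M" using x by (simp add: smult_closed)
  then have "?z \<oplus>\<^bsub>M\<^esub> ?z = ?z \<oplus>\<^bsub>M\<^esub> \<zero>\<^bsub>M\<^esub>"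
    using x smult_l_distr[of "\<zero>\<^bsub>R\<^esub>" "\<zero>\<^bsub>R\<^esub>" x] by (metis M.r_zero R.r_zero R.zero_closed)
  then show ?thesis
    using z by (metis M.add.l_cancel_one M.r_zero)
qed

lemma annihilator_ideal:
  "ideal {a \<in> carrier R. \<forall>x\<in>carrier M. a \<odot>\<^bsub>M\<^esub> x = \<zero>\<^bsub>M\<^esub>} R" (is "ideal ?I R")
proof (rule idealI)
  show "ring R" by (rule R.ring_axioms)
  show "subgroup ?I (add_monoid R)"
  proof (rule R.add.subgroupI)
    show "?I \<noteq> {}"
      using smult_zero_left by blast
  next
    fix a assume a: "a \<in> ?I"
    have "(\<ominus>\<^bsub>R\<^esub> a) \<odot>\<^bsub>M\<^esub> x = \<zero>\<^bsub>M\<^esub>" if x: "x \<in> carrier M" for x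
    proof -
      have "(\<ominus>\<^bsub>R\<^esub> a) \<odot>\<^bsub>M\<^esub> x = (\<ominus>\<^bsub>R\<^esub> a \<oplus>\<^bsub>R\<^esub> a) \<odot>\<^bsub>M\<^esub> x"
        using a x smult_l_distr[of "\<ominus>\<^bsub>R\<^esub> a" a x] smult_closed[of "\<ominus>\<^bsub>R\<^esub> a" x] by simp
      then show ?thesis
        using a x by (simp add: R.l_neg smult_zero_left)
    qed
    then show "\<ominus>\<^bsub>R\<^esub> a \<in> ?I"
      using a by simp
  qed (auto simp: smult_l_distr)
qed (auto simp: smult_assoc smult_zero_right smult_closed)

text \<open>
  The module over the quotient is described by the values of its scalar multiplication on cosets
  of elements, so that no particular choice of representatives enters.
\<close>
lemma left_module_Quot:
  assumes I: "ideal I R"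
    and group_N: "carrier N = carrier M" "add N = add M" "zero N = zero M"
    and smult_N: "\<And>a x. \<lbrakk>a \<in> carrier R; x \<in> carrier M\<rbrakk> \<Longrightarrow> (I +>\<^bsub>R\<^esub> a) \<odot>\<^bsub>N\<^esub> x = a \<odot>\<^bsub>M\<^esub> x"
  shows "left_module (R Quot I) N"
proof -
  interpret I: ideal I R by (rule I)
  have N: "abelian_group N"
    by (rule abelian_group_cong[OF M.abelian_group_axioms group_N])
  have carrier: "carrier (R Quot I) = (+>\<^bsub>R\<^esub>) I ` carrier R"
    by (auto simp: FactRing_simps)
  have ops: "(I +>\<^bsub>R\<^esub> a) \<oplus>\<^bsub>R Quot I\<^esub> (I +>\<^bsub>R\<^esub> b) = I +>\<^bsub>R\<^esub> (a \<oplus>\<^bsub>R\<^esub> b)"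
    "(I +>\<^bsub>R\<^esub> a) \<otimes>\<^bsub>R Quot I\<^esub> (I +>\<^bsub>R\<^esub> b) = I +>\<^bsub>R\<^esub> (a \<otimes>\<^bsub>R\<^esub> b)"
    if "a \<in> carrier R" "b \<in> carrier R" for a b
    using ring_hom_add[OF I.rcos_ring_hom that] ring_hom_mult[OF I.rcos_ring_hom that] by simp_all
  have one: "\<one>\<^bsub>R Quot I\<^esub> = I +>\<^bsub>R\<^esub> \<one>\<^bsub>R\<^esub>"
    using ring_hom_one[OF I.rcos_ring_hom] by simp
  show ?thesis
    by (intro left_module.intro left_module_axioms.intro I.quotient_is_ring N)
      (auto simp: carrier group_N ops one smult_N smult_closed smult_l_distr smult_r_distr smult_assoc smult_one)
qed

text \<open>
  Elements of a coset of an annihilating ideal act alike. This yields a scalar multiplication as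
  required for the quotient: let a coset act through an arbitrarily chosen element.
\<close>
lemma coset_representative_smult:
  assumes I: "ideal I R"
    and annihilates: "\<And>a x. \<lbrakk>a \<in> I; x \<in> carrier M\<rbrakk> \<Longrightarrow> a \<odot>\<^bsub>M\<^esub> x = \<zero>\<^bsub>M\<^esub>"
    and a: "a \<in> carrier R" and x: "x \<in> carrier M"
  shows "(SOME b. b \<in> I +>\<^bsub>R\<^esub> a) \<odot>\<^bsub>M\<^esub> x = a \<odot>\<^bsub>M\<^esub> x"
proof -
  interpret I: ideal I R by (rule I)
  have "(SOME b. b \<in> I +>\<^bsub>R\<^esub> a) \<in> I +>\<^bsub>R\<^esub> a"
    by (rule someI) (rule I.a_rcos_self[OF a])
  then obtain i where i: "i \<in> I" "(SOME b. b \<in> I +>\<^bsub>R\<^esub> a) = i \<oplus>\<^bsub>R\<^esub> a"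
    by (auto simp: a_r_coset_def r_coset_def)
  then show ?thesis
    using a x I.a_Hcarr[OF i(1)] by (simp add: smult_l_distr annihilates smult_closed)
qed

end

section \<open>Representations of the free algebra by linear operators\<close>

text \<open>
  A word acts as the composition of the operators of its letters, the last letter acting first;
  this order makes the product of the free algebra correspond to the composition of operators.
\<close>
definition free_alg_action :: "('g \<Rightarrow> crat \<Rightarrow> crat) \<Rightarrow> 'g free_alg \<Rightarrow> crat \<Rightarrow> crat" where
  "free_alg_action T p f =
     (\<Sum>w\<in>Poly_Mapping.keys p. of_cpoly (const (Poly_Mapping.lookup p w)) * foldr T (letters w) f)"

locale linear_operators =
  fixes T :: "'g \<Rightarrow> crat \<Rightarrow> crat"
  assumes T_add: "T g (f + h) = T g f + T g h"
    and T_scale: "T g (of_cpoly (const c) * f) = of_cpoly (const c) * T g f"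
begin

lemma foldr_add: "foldr T xs (f + h) = foldr T xs f + foldr T xs h"
  by (induction xs) (simp_all add: T_add)

lemma foldr_scale: "foldr T xs (of_cpoly (const c) * f) = of_cpoly (const c) * foldr T xs f"
  by (induction xs) (simp_all add: T_scale)

lemma action_single:
  "free_alg_action T (Poly_Mapping.single w c) f = of_cpoly (const c) * foldr T (letters w) f"
  by (cases "c = 0") (simp_all add: free_alg_action_def of_cpoly_0)

lemma action_add: "free_alg_action T (p + q) f = free_alg_action T p f + free_alg_action T q f"
  unfolding free_alg_action_def
proof (rule sum_keys_add)
  show "of_cpoly (const 0) * foldr T (letters w) f = 0" for w
    by (simp add: of_cpoly_0)
  have "of_cpoly (const (a + b)) = of_cpoly (const a) + of_cpoly (const b)" for a b
    by (simp add: single_add)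
  then show "of_cpoly (const (a + b)) * foldr T (letters w) f =
      of_cpoly (const a) * foldr T (letters w) f + of_cpoly (const b) * foldr T (letters w) f" for w a b
    by (simp only: distrib_right)
qed

lemma action_diff: "free_alg_action T (p - q) f = free_alg_action T p f - free_alg_action T q f"
  using action_add[of "p - q" q f] by simp

lemma action_add_right: "free_alg_action T p (f + h) = free_alg_action T p f + free_alg_action T p h"
  by (simp add: free_alg_action_def foldr_add distrib_left sum.distrib)

lemma action_mult: "free_alg_action T (p * q) f = free_alg_action T p (free_alg_action T q f)"
proof (induction p rule: poly_mapping_additive_induct)
  case (single u a)
  show ?case
  proof (induction q rule: poly_mapping_additive_induct)
    case (single v b)
    have "Poly_Mapping.single u a * Poly_Mapping.single v b = Poly_Mapping.single (u + v) (a * b)"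
      by (rule mult_single)
    moreover have "of_cpoly (const (a * b)) = of_cpoly (const a) * of_cpoly (const b)"
      by (simp add: mult_single)
    ultimately show ?case
      by (simp only: action_single plus_free_monoid_def free_monoid.sel foldr_append comp_apply
          foldr_scale mult.assoc)
  qed (simp add: distrib_left action_add action_add_right)
qed (simp add: distrib_right action_add)

lemma action_const: "free_alg_action T (const c) f = of_cpoly (const c) * f"
  by (simp add: action_single zero_free_monoid_def)

lemma action_1: "free_alg_action T 1 f = f"
  using action_const[of 1 f] by (simp add: of_cpoly_1)

lemma action_0: "free_alg_action T 0 f = 0"
  using action_const[of 0 f] by (simp add: of_cpoly_0)

lemma action_gen: "free_alg_action T (gen g) f = T g f"
  by (simp add: gen_def action_single of_cpoly_1)

lemma action_closed:
  assumes S: "unital_subring S" and const: "\<And>c. of_cpoly (const c) \<in> S"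
    and T: "\<And>g f. \<lbrakk>g \<in> G; f \<in> S\<rbrakk> \<Longrightarrow> T g f \<in> S"
    and p: "p \<in> carrier (free_alg_on G)" and f: "f \<in> S"
  shows "free_alg_action T p f \<in> S"
  unfolding free_alg_action_def
proof (intro unital_subring.sum_closed[OF S] unital_subring.mult_closed[OF S] const)
  fix w assume "w \<in> Poly_Mapping.keys p"
  then have "set (letters w) \<subseteq> G"
    using p by (simp add: free_alg_on_def ring_on_def)
  moreover have "set xs \<subseteq> G \<Longrightarrow> foldr T xs f \<in> S" for xs
    by (induction xs) (simp_all add: f T)
  ultimately show "foldr T (letters w) f \<in> S" by blast
qed

end

lemma free_alg_on_carrier: "p \<in> carrier (free_alg_on G) \<longleftrightarrow> (\<forall>w\<in>Poly_Mapping.keys p. set (letters w) \<subseteq> G)"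
  by (simp add: free_alg_on_def ring_on_def)

lemma free_alg_on_ops:
  "monoid.mult (free_alg_on G) = (*)" "add (free_alg_on G) = (+)"
  "one (free_alg_on G) = 1" "zero (free_alg_on G) = 0"
  by (simp_all add: free_alg_on_def ring_on_def)

lemma unital_subring_free_alg_on: "unital_subring (carrier (free_alg_on G))"
proof
  show "1 \<in> carrier (free_alg_on G)"
    by (simp add: free_alg_on_carrier zero_free_monoid_def)
next
  fix p q assume pq: "p \<in> carrier (free_alg_on G)" "q \<in> carrier (free_alg_on G)"
  show "p - q \<in> carrier (free_alg_on G)"
    using pq Poly_Mapping.keys_diff[of p q] unfolding free_alg_on_carrier by blast
  have "set (letters w) \<subseteq> G" if w: "w \<in> Poly_Mapping.keys (p * q)" for w
  proof -
    obtain u v where "w = u + v" "u \<in> Poly_Mapping.keys p" "v \<in> Poly_Mapping.keys q"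
      using w Poly_Mapping.keys_mult[of p q] by blast
    then show ?thesis
      using pq by (auto simp: plus_free_monoid_def free_alg_on_carrier)
  qed
  then show "p * q \<in> carrier (free_alg_on G)" by (simp add: free_alg_on_carrier)
qed

lemma ring_free_alg_on: "ring (free_alg_on G)"
  using unital_subring.ring_ring_on[OF unital_subring_free_alg_on, of G]
  by (simp add: free_alg_on_def ring_on_def)

lemma gen_in_free_alg_on: "gen g \<in> carrier (free_alg_on G) \<longleftrightarrow> g \<in> G"
  by (simp add: free_alg_on_carrier gen_def)

lemma const_in_free_alg_on: "const c \<in> carrier (free_alg_on G)"
  by (simp add: free_alg_on_carrier zero_free_monoid_def)

lemma subst_poly_in_free_alg_on:
  assumes "\<And>j. j < n \<Longrightarrow> v j \<in> carrier (free_alg_on G)"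
  shows "subst_poly n v p \<in> carrier (free_alg_on G)"
  unfolding subst_poly_def
  using assms
  by (intro unital_subring.sum_closed[OF unital_subring_free_alg_on]
      unital_subring.mult_closed[OF unital_subring_free_alg_on]
      unital_subring.prod_list_closed[OF unital_subring_free_alg_on] const_in_free_alg_on)
    (auto intro: unital_subring.power_closed[OF unital_subring_free_alg_on])

section \<open>The action of the localized Weyl algebra\<close>

primrec weyl_op :: "nat \<Rightarrow> weyl_gen \<Rightarrow> crat \<Rightarrow> crat" where
  "weyl_op n (GY j) f = of_cpoly (Y n j) * f"
| "weyl_op n (GD j) f = dy n j f"
| "weyl_op n GInv f = inverse (of_cpoly (Delta n ^ 2)) * f"

interpretation weyl: linear_operators "weyl_op n" for n
proof
  fix g c f h
  show "weyl_op n g (f + h) = weyl_op n g f + weyl_op n g h"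
    by (cases g) (simp_all only: weyl_op.simps dy_add distrib_left)
  show "weyl_op n g (of_cpoly (const c) * f) = of_cpoly (const c) * weyl_op n g f"
    by (cases g) (simp_all only: weyl_op.simps dy_mult dy_const mult_zero_left add_0 mult.left_commute)
qed

text \<open>
  Powers and products of commuting multiplication operators are again multiplication operators,
  whatever the order in which the noncommutative substitution multiplies the generators.
\<close>
lemma action_subst_Y:
  "free_alg_action (weyl_op n) (subst_poly n (\<lambda>j. gen (GY j)) P) f = of_cpoly (subst_poly n (Y n) P) * f"
proof (induction P rule: poly_mapping_additive_induct)
  case (single m c)
  have step: "of_cpoly p * (of_cpoly q * f) = of_cpoly (p * q) * f" for p q f
    by (simp flip: mult.assoc)
  have power: "free_alg_action (weyl_op n) (gen (GY j) ^ k) f = of_cpoly (Y n j ^ k) * f" for j k f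
  proof (induction k)
    case 0
    show ?case by (simp add: weyl.action_1 of_cpoly_1)
  next
    case (Suc k)
    then show ?case
      by (simp only: power_Suc weyl.action_mult weyl.action_gen weyl_op.simps step)
  qed
  have "free_alg_action (weyl_op n) (prod_list (map (\<lambda>j. gen (GY j) ^ Poly_Mapping.lookup m j) js)) f =
      of_cpoly (prod_list (map (\<lambda>j. Y n j ^ Poly_Mapping.lookup m j) js)) * f" for js
  proof (induction js)
    case Nil
    show ?case by (simp add: weyl.action_1 of_cpoly_1)
  next
    case (Cons j js)
    then show ?case
      by (simp only: list.map prod_list.Cons weyl.action_mult power step)
  qed
  then show ?case
    by (simp only: subst_poly_single weyl.action_mult weyl.action_const step)
next
  case (add p q)
  have "of_cpoly (subst_poly n (Y n) p + subst_poly n (Y n) q) =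
      of_cpoly (subst_poly n (Y n) p) + of_cpoly (subst_poly n (Y n) q)"
    by simp
  then show ?case
    using add by (simp only: subst_poly_add weyl.action_add distrib_right)
qed

lemma weyl_relators_in_free_alg: "weyl_relators n \<subseteq> carrier (free_alg_on (weyl_gens n))"
proof -
  note closed = unital_subring.diff_closed[OF unital_subring_free_alg_on]
    unital_subring.mult_closed[OF unital_subring_free_alg_on]
    unital_subring.one_closed[OF unital_subring_free_alg_on]
    unital_subring.zero_closed[OF unital_subring_free_alg_on]
  have gens: "j < n \<Longrightarrow> gen (GY j) \<in> carrier (free_alg_on (weyl_gens n))"
    "j < n \<Longrightarrow> gen (GD j) \<in> carrier (free_alg_on (weyl_gens n))"
    "gen GInv \<in> carrier (free_alg_on (weyl_gens n))" for j
    by (auto simp: gen_in_free_alg_on weyl_gens_def)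
  have Delta: "subst_poly n (\<lambda>j. gen (GY j)) (Delta_sq_poly n) \<in> carrier (free_alg_on (weyl_gens n))"
    by (rule subst_poly_in_free_alg_on) (rule gens)
  show ?thesis
    unfolding weyl_relators_def by (auto intro!: closed gens Delta)
qed

lemma weyl_relators_act_as_0:
  assumes "r \<in> weyl_relators n"
  shows "free_alg_action (weyl_op n) r f = 0"
proof -
  note action = weyl.action_diff weyl.action_mult weyl.action_gen weyl.action_1
    action_subst_Y Delta_sq_poly_spec(2) weyl_op.simps
  have "of_cpoly (Delta n ^ 2) \<noteq> 0"
    using Delta_nonzero by (simp add: Zero_fract_def eq_fract)
  then have "inverse (of_cpoly (Delta n ^ 2)) * of_cpoly (Delta n ^ 2) = 1"
    "of_cpoly (Delta n ^ 2) * inverse (of_cpoly (Delta n ^ 2)) = 1"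
    by (rule left_inverse, rule right_inverse)
  then have inv: "inverse (of_cpoly (Delta n ^ 2)) * (of_cpoly (Delta n ^ 2) * f) = f"
    "of_cpoly (Delta n ^ 2) * (inverse (of_cpoly (Delta n ^ 2)) * f) = f"
    by (simp_all only: mult.assoc[symmetric] mult_1_left)
  from assms consider
      (YY) i j where "i < n" "j < n" "r = gen (GY i) * gen (GY j) - gen (GY j) * gen (GY i)"
    | (DD) i j where "i < n" "j < n" "r = gen (GD i) * gen (GD j) - gen (GD j) * gen (GD i)"
    | (DY) i j where "i < n" "j < n"
        "r = gen (GD i) * gen (GY j) - gen (GY j) * gen (GD i) - (if i = j then 1 else 0)"
    | (left) "r = gen GInv * subst_poly n (\<lambda>j. gen (GY j)) (Delta_sq_poly n) - 1"
    | (right) "r = subst_poly n (\<lambda>j. gen (GY j)) (Delta_sq_poly n) * gen GInv - 1"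
    unfolding weyl_relators_def by blast
  then show ?thesis
  proof cases
    case YY
    then show ?thesis
      by (simp only: action mult.left_commute[of "of_cpoly (Y n i)"] diff_self)
  next
    case DD
    then show ?thesis
      by (simp only: action dy_commute[of i n j] diff_self)
  next
    case DY
    then have "free_alg_action (weyl_op n) r f =
        (if i = j then 1 else 0) * f - free_alg_action (weyl_op n) (if i = j then 1 else 0) f"
      by (simp only: action dy_mult dy_Y add_diff_cancel_right')
    then show ?thesis
      by (simp add: weyl.action_1 weyl.action_0)
  next
    case left
    then show ?thesis by (simp only: action inv diff_self)
  next
    case right
    then show ?thesis by (simp only: action inv diff_self)
  qed
qed

lemma weyl_op_in_OX:
  assumes "g \<in> weyl_gens n" "f \<in> OX n"
  shows "weyl_op n g f \<in> OX n"
proof -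
  have "Y n j \<in> polys_in n" for j
    unfolding Y_def
    by (intro unital_subring.sum_closed[OF unital_subring_polys_in]
        unital_subring.power_closed[OF unital_subring_polys_in] X_in_polys_in) simp
  moreover have "inverse (of_cpoly (Delta n ^ 2)) \<in> OX n"
    using OX_memI[OF unital_subring.one_closed[OF unital_subring_polys_in], of n 2] by simp
  ultimately show ?thesis
    using assms
    by (auto simp: weyl_gens_def simp del: inverse_fract
        intro!: unital_subring.mult_closed[OF unital_subring_OX] of_cpoly_in_OX dy_in_OX)
qed

lemma left_module_free_alg:
  "left_module (free_alg_on (weyl_gens n)) (OX_module n (free_alg_action (weyl_op n)))"
proof (intro left_module.intro left_module_axioms.intro ring_free_alg_on)
  have "abelian_group (ring_on (OX n))"
    using unital_subring.ring_ring_on[OF unital_subring_OX] by (rule ring.is_abelian_group)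
  then show "abelian_group (OX_module n (free_alg_action (weyl_op n)))"
    by (rule abelian_group_cong) (simp_all add: OX_module_def ring_on_def)
  show "p \<odot>\<^bsub>OX_module n (free_alg_action (weyl_op n))\<^esub> f \<in> carrier (OX_module n (free_alg_action (weyl_op n)))"
    if "p \<in> carrier (free_alg_on (weyl_gens n))" "f \<in> carrier (OX_module n (free_alg_action (weyl_op n)))" for p f
    using that weyl.action_closed[OF unital_subring_OX of_cpoly_in_OX[OF const_in_polys_in] weyl_op_in_OX]
    by (simp add: OX_module_def)
qed (simp_all add: OX_module_def free_alg_on_ops weyl.action_add weyl.action_add_right
    weyl.action_mult weyl.action_1)

lemma weyl_ideal_is_ideal: "ideal (weyl_ideal n) (free_alg_on (weyl_gens n))"
  unfolding weyl_ideal_def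
  by (rule ring.genideal_ideal[OF ring_free_alg_on weyl_relators_in_free_alg])

text \<open>
  The annihilator is an ideal that contains the relators, hence it contains the ideal they
  generate.
\<close>
lemma weyl_ideal_acts_as_0:
  assumes "p \<in> weyl_ideal n" "f \<in> OX n"
  shows "free_alg_action (weyl_op n) p f = 0"
proof -
  let ?R = "free_alg_on (weyl_gens n)" and ?M = "OX_module n (free_alg_action (weyl_op n))"
  let ?I = "{a \<in> carrier ?R. \<forall>x\<in>carrier ?M. a \<odot>\<^bsub>?M\<^esub> x = \<zero>\<^bsub>?M\<^esub>}"
  have "weyl_relators n \<subseteq> ?I"
    using weyl_relators_in_free_alg weyl_relators_act_as_0 by (auto simp: OX_module_def)
  then have "weyl_ideal n \<subseteq> ?I"
    unfolding weyl_ideal_def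
    by (rule ring.genideal_minimal[OF ring_free_alg_on left_module.annihilator_ideal[OF left_module_free_alg]])
  then show ?thesis
    using assms by (auto simp: OX_module_def)
qed

theorem lemma3p1:
  fixes n :: nat
  assumes "n \<ge> 1"
  shows "\<exists>A_inv act.
      A_inv \<in> carrier_mat n n \<and> elements_mat A_inv \<subseteq> OX n \<and>
      inverts_mat (A_mat n) A_inv \<and> inverts_mat A_inv (A_mat n) \<and>
      left_module (DY n) (OX_module n act) \<and>
      (\<forall>f \<in> OX n.
         (\<forall>c. act (DY_class n (const c)) f = of_cpoly (const c) * f) \<and>
         (\<forall>j<n. act (DY_class n (gen (GY j))) f = of_cpoly (Y n j) * f) \<and>
         act (DY_class n (gen GInv)) f = inverse (of_cpoly (Delta n ^ 2)) * f \<and>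
         (\<forall>j<n. act (DY_class n (gen (GD j))) f = (A_inv *\<^sub>v vec n (\<lambda>i. drat i f)) $ j))"
proof -
  let ?R = "free_alg_on (weyl_gens n)" and ?M = "OX_module n (free_alg_action (weyl_op n))"
  define act where "act C f = free_alg_action (weyl_op n) (SOME p. p \<in> C) f" for C f
  interpret M: left_module ?R ?M by (rule left_module_free_alg)
  have annihilates: "a \<odot>\<^bsub>?M\<^esub> x = \<zero>\<^bsub>?M\<^esub>" if "a \<in> weyl_ideal n" "x \<in> carrier ?M" for a x
    using weyl_ideal_acts_as_0 that by (simp add: OX_module_def)
  have act: "act (DY_class n p) f = free_alg_action (weyl_op n) p f"
    if "p \<in> carrier ?R" "f \<in> OX n" for p f
    using M.coset_representative_smult[OF weyl_ideal_is_ideal annihilates, of p f] that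
    by (simp add: act_def DY_class_def OX_module_def)
  have "left_module (DY n) (OX_module n act)"
    unfolding DY_def
    by (rule M.left_module_Quot[OF weyl_ideal_is_ideal])
      (use act in \<open>auto simp: OX_module_def DY_class_def\<close>)
  moreover have "elements_mat (A_inverse n) \<subseteq> OX n"
    using A_inverse_carrier[of n] by (auto simp: elements_mat_def A_inverse_in_OX)
  moreover have "inverts_mat (A_mat n) (A_inverse n)" "inverts_mat (A_inverse n) (A_mat n)"
    using A_mat_carrier[of n] A_inverse_carrier[of n] by (simp_all add: inverts_mat_def A_mat_inverse)
  moreover have "act (DY_class n (const c)) f = of_cpoly (const c) * f" if "f \<in> OX n" for c f
    using that by (simp add: act const_in_free_alg_on weyl.action_const)
  moreover have "act (DY_class n (gen g)) f = weyl_op n g f" if "g \<in> weyl_gens n" "f \<in> OX n" for g f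
    using that by (simp add: act gen_in_free_alg_on weyl.action_gen)
  moreover have "dy n j f = (A_inverse n *\<^sub>v vec n (\<lambda>i. drat i f)) $ j" if "j < n" for j f
    using that A_inverse_carrier[of n] by (auto simp: dy_def scalar_prod_def lessThan_atLeast0)
  ultimately show ?thesis
    using A_inverse_carrier[of n]
    by (intro exI[of _ "A_inverse n"] exI[of _ act]) (auto simp: weyl_gens_def)
qed

end
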